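(* Let the neighbor graph $\mathbb{G}$ be an undirected complete graph with weights $w_{ij}=1$ for all $i\ne j$, $i,j\in\mathcal{V}$, and let $x_e^\ast=[\mathbf{0}_{n_1}^\top,\mathbf{1}_{n_2}^\top]^\top$ with $n_1\in\{2,\dots,N-2\}$ and $n_1+n_2=N$. The equilibrium $x_e^\ast$ of the system $x(k+1)=F(x(k))$ is unstable when $b_i=1$ for all $i\in\mathcal{V}$, and is locally exponentially stable when $b_i>1$ for all $i\in\mathcal{V}$.
   Context: There are $N$ agents, $\mathcal{V}=\{1,\dots,N\}$. $\mathbb{G}=(\mathcal{V},\mathcal{E})$ is a graph without self-loops, $\mathcal{N}_i=\{j\in\mathcal{V}:(j,i)\in\mathcal{E}\}$ is the set of neighbors of agent $i$ (so $i\notin\mathcal{N}_i$; for the complete graph $\mathcal{N}_i=\mathcal{V}\setminus\{i\}$). The weight matrix $W=(w_{ij})_{N\times N}$ has self-weights $w_{ii}\ge 0$. Each agent $i$ has a real bias parameter $b_i$. Put $d_i=\sum_{j\in\mathcal{N}_i}w_{ij}$ and, for $x=(x_1,\dots,x_N)^\top$, $s_i=\sum_{j\in\mathcal{N}_i}w_{ij}x_j$ and $$f_i(x)=\frac{w_{ii}x_i+x_i^{b_i}s_i}{w_{ii}+x_i^{b_i}s_i+(1-x_i)^{b_i}(d_i-s_i)},\qquad F(x)=[f_1(x),\dots,f_N(x)]^\top.$$ The opinion dynamics is $x(k+1)=F(x(k))$, $k=0,1,2,\dots$, with $x_i(0)\in[0,1]$ for all $i$; the state space is $[0,1]^N$.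 $\mathbf{0}_n$ and $\mathbf{1}_n$ are the $n$-dimensional all-zero and all-one vectors. An equilibrium is a point $x^\ast$ with $F(x^\ast)=x^\ast$; local exponential stability and instability are in the usual (Lyapunov) sense for discrete-time systems on this state space. *)

theory Defs
  imports "HOL-Analysis.Analysis"
begin

text \<open>The set of agents \<open>1, \<dots>, N\<close> is a finite, linearly ordered type \<open>'n\<close> with
  \<open>CARD('n) = N\<close>; an edge \<open>(j, i)\<close> means that agent \<open>i\<close> listens to agent \<open>j\<close>.\<close>

definition neighbors :: "('n \<times> 'n) set \<Rightarrow> 'n \<Rightarrow> 'n set" where
  "neighbors E i = {j. (j, i) \<in> E}"

definition undirected_complete_graph :: "('n \<times> 'n) set \<Rightarrow> bool" where
  "undirected_complete_graph E \<longleftrightarrow> irrefl E \<and> sym E \<and> (\<forall>i j. i \<noteq> j \<longrightarrow> (j, i) \<in> E)"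

definition nbr_weight :: "('n::finite \<times> 'n) set \<Rightarrow> real^'n^'n \<Rightarrow> 'n \<Rightarrow> real" where
  "nbr_weight E W i = (\<Sum>j\<in>neighbors E i. W $ i $ j)"

definition nbr_opinion :: "('n::finite \<times> 'n) set \<Rightarrow> real^'n^'n \<Rightarrow> real^'n \<Rightarrow> 'n \<Rightarrow> real" where
  "nbr_opinion E W x i = (\<Sum>j\<in>neighbors E i. W $ i $ j * x $ j)"

text \<open>The map \<open>F = (f\<^sub>1, \<dots>, f\<^sub>N)\<close>, where \<open>d\<^sub>i\<close> is \<^const>\<open>nbr_weight\<close> and \<open>s\<^sub>i\<close> is
  \<^const>\<open>nbr_opinion\<close>. For \<open>b i > 0\<close> and \<open>x $ i \<ge> 0\<close>, \<open>powr\<close> is the ordinary power (with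
  \<open>0 powr b i = 0\<close>). Where the denominator vanishes, \<open>f\<^sub>i\<close> takes the value 0.\<close>

definition opinion_map ::
    "('n::finite \<times> 'n) set \<Rightarrow> real^'n^'n \<Rightarrow> ('n \<Rightarrow> real) \<Rightarrow> real^'n \<Rightarrow> real^'n" where
  "opinion_map E W b x = (\<chi> i.
     (W $ i $ i * x $ i + x $ i powr b i * nbr_opinion E W x i) /
     (W $ i $ i + x $ i powr b i * nbr_opinion E W x i
        + (1 - x $ i) powr b i * (nbr_weight E W i - nbr_opinion E W x i)))"

definition opinion_space :: "(real^'n) set" where
  "opinion_space = {x. \<forall>i. 0 \<le> x $ i \<and> x $ i \<le> 1}"

text \<open>The block vector \<open>[0\<^sub>n\<^sub>1\<^sup>T, 1\<^sub>n\<^sub>2\<^sup>T]\<^sup>T\<close>; \<open>card {..<i}\<close> is the position of \<open>i\<close> in the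
  ordering of the agents, counted from 0.\<close>

definition zeros_ones :: "nat \<Rightarrow> nat \<Rightarrow> real^'n::{finite,linorder}" where
  "zeros_ones n1 n2 = (\<chi> i. (replicate n1 0 @ replicate n2 1) ! card {..<i})"

text \<open>Stability notions for the system \<open>x (k + 1) = F (x k)\<close> with initial states in \<open>X\<close>.\<close>

definition equilibrium :: "('a \<Rightarrow> 'a) \<Rightarrow> 'a set \<Rightarrow> 'a \<Rightarrow> bool" where
  "equilibrium F X p \<longleftrightarrow> p \<in> X \<and> F p = p"

definition lyapunov_stable :: "('a::metric_space \<Rightarrow> 'a) \<Rightarrow> 'a set \<Rightarrow> 'a \<Rightarrow> bool" where
  "lyapunov_stable F X p \<longleftrightarrow>
     (\<forall>\<epsilon>>0. \<exists>\<delta>>0. \<forall>x0\<in>X. dist x0 p < \<delta> \<longrightarrow> (\<forall>k. dist ((F ^^ k) x0) p < \<epsilon>))"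

definition unstable :: "('a::metric_space \<Rightarrow> 'a) \<Rightarrow> 'a set \<Rightarrow> 'a \<Rightarrow> bool" where
  "unstable F X p \<longleftrightarrow> \<not> lyapunov_stable F X p"

definition locally_exponentially_stable ::
    "('a::metric_space \<Rightarrow> 'a) \<Rightarrow> 'a set \<Rightarrow> 'a \<Rightarrow> bool" where
  "locally_exponentially_stable F X p \<longleftrightarrow>
     (\<exists>\<delta>>0. \<exists>C>0. \<exists>\<rho>. 0 < \<rho> \<and> \<rho> < 1 \<and>
        (\<forall>x0\<in>X. dist x0 p < \<delta> \<longrightarrow> (\<forall>k. dist ((F ^^ k) x0) p \<le> C * \<rho> ^ k * dist x0 p)))"

end

theory Submission
  imports Defs
begin

text \<open>
  Everything is expressed through the deviations \<open>y\<^sub>i = \<bar>x\<^sub>i - p\<^sub>i\<bar>\<close> from a vector \<open>p\<close> of zeros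
  and ones. The update rule is symmetric under exchanging the two opinions 0 and 1, so the
  deviation of an agent obeys the same law whichever of the two poles it starts from: with
  \<open>u\<close> the total opinion of the other agents against the pole of agent \<open>i\<close> and \<open>v\<close> their total
  opinion in favour of it,
  \<open>y\<^sub>i' = (w y\<^sub>i + y\<^sub>i\<^sup>b u) / (w + y\<^sub>i\<^sup>b u + (1 - y\<^sub>i)\<^sup>b v)\<close>
  (lemma \<open>opinion_map_deviation\<close>). Near \<open>p\<close>, \<open>u\<close> and \<open>v\<close> are close to the number of agents at the
  other pole and to the number of further agents at the same pole; the latter is at least 1 as
  both groups have two members or more.

  For \<open>b > 1\<close> the term \<open>y\<^sup>b u\<close> is of higher order, so \<open>y' \<approx> y w / (w + v)\<close> with \<open>v\<close> at least about 1.
  Hence each deviation separately shrinks by a factor \<open>\<rho> < 1\<close>, which gives exponential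
  stability at once, in the Euclidean norm and with constant \<open>C = 1\<close>
  (lemma \<open>polarized_exponentially_stable\<close>).

  For \<open>b = 1\<close> one has \<open>y' \<approx> y (w + u) / (w + v)\<close>. For an agent of the group that is not the larger
  one, \<open>u \<ge> v + 1\<close>, so this factor exceeds 1. An agent sitting exactly at its pole never leaves it;
  therefore the line through \<open>p\<close> on which only this one agent deviates is invariant, and along it
  the deviation grows geometrically until it exceeds \<open>1/2\<close> (lemma \<open>polarized_unstable\<close>).
\<close>

section \<open>The scalar update rule\<close>

text \<open>The new opinion of an agent with self-weight \<open>w\<close>, bias \<open>b\<close> and opinion \<open>t\<close>, where \<open>u\<close> and \<open>v\<close>
  are the weights with which its neighbours support the opinions 1 and 0.\<close>

definition biased_update :: "real \<Rightarrow> real \<Rightarrow> real \<Rightarrow> real \<Rightarrow> real \<Rightarrow> real" where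
  "biased_update w b t u v =
     (w * t + t powr b * u) / (w + t powr b * u + (1 - t) powr b * v)"

lemma biased_update_bounds:
  assumes "0 \<le> w" "0 \<le> t" "t \<le> 1" "0 \<le> u" "0 \<le> v"
  shows "0 \<le> biased_update w b t u v" "biased_update w b t u v \<le> 1"
proof -
  have "0 \<le> w * t" "w * t \<le> w" "0 \<le> t powr b * u" "0 \<le> (1 - t) powr b * v"
    using assms by (auto simp: mult_left_le)
  then show "0 \<le> biased_update w b t u v" "biased_update w b t u v \<le> 1"
    unfolding biased_update_def by (auto simp: divide_le_eq_1)
qed

lemma biased_update_denominator_pos:
  fixes t :: real
  assumes "0 \<le> w" "t < 1" "0 \<le> u" "0 < v"
  shows "0 < w + t powr b * u + (1 - t) powr b * v"
  using assms by (intro add_nonneg_pos add_nonneg_nonneg mult_pos_pos mult_nonneg_nonneg) auto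

text \<open>Numerator and denominator differ by the numerator with the two opinions exchanged, so the
  rule is equivariant under \<open>t \<mapsto> 1 - t\<close> wherever the denominator does not vanish.\<close>

lemma biased_update_flip:
  assumes "w + t powr b * u + (1 - t) powr b * v \<noteq> 0"
  shows "1 - biased_update w b t u v = biased_update w b (1 - t) v u"
proof -
  have "w + (1 - t) powr b * v + (1 - (1 - t)) powr b * u
      = w + t powr b * u + (1 - t) powr b * v"
    by simp
  then show ?thesis
    unfolding biased_update_def using assms by (simp add: field_simps)
qed

lemma biased_update_0 [simp]: "biased_update w b 0 u v = 0"
  by (simp add: biased_update_def)

text \<open>Writing \<open>t\<^sup>b = t t\<^bsup>b-1\<^esup>\<close> exposes a factor \<open>t\<close> in the numerator; what remains is monotone in
  \<open>t\<close>, \<open>u\<close> and \<open>v\<close>, so the contraction need only be checked at the extreme values.\<close>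

lemma biased_update_contracts:
  assumes "0 \<le> w" "1 < b" "0 \<le> t" "t \<le> \<delta>" "\<delta> < 1" "0 \<le> u" "u \<le> U" "1 - \<delta> \<le> v" "0 \<le> \<rho>"
    and small: "w + \<delta> powr (b - 1) * U \<le> \<rho> * (w + (1 - \<delta>) powr b * (1 - \<delta>))"
  shows "biased_update w b t u v \<le> \<rho> * t"
proof -
  let ?D = "w + t powr b * u + (1 - t) powr b * v"
  have D: "?D > 0"
    using assms by (intro biased_update_denominator_pos) auto
  have split: "t powr b = t * t powr (b - 1)"
    using assms by (cases "t = 0") (auto simp: powr_diff)
  have "t powr (b - 1) * u \<le> \<delta> powr (b - 1) * U"
    using assms by (intro mult_mono powr_mono2) auto
  also have "w + \<dots> \<le> \<rho> * (w + (1 - \<delta>) powr b * (1 - \<delta>))"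
    by (fact small)
  also have "\<dots> \<le> \<rho> * ?D"
  proof -
    have "(1 - \<delta>) powr b * (1 - \<delta>) \<le> (1 - t) powr b * v"
      using assms by (intro mult_mono powr_mono2) auto
    moreover have "0 \<le> t powr b * u"
      using assms by simp
    ultimately show ?thesis
      using \<open>0 \<le> \<rho>\<close> by (intro mult_left_mono) auto
  qed
  finally have "t * (w + t powr (b - 1) * u) \<le> t * (\<rho> * ?D)"
    using \<open>0 \<le> t\<close> by (intro mult_left_mono) auto
  then have "w * t + t powr b * u \<le> \<rho> * t * ?D"
    by (subst split) (simp add: algebra_simps)
  then show ?thesis
    unfolding biased_update_def using D by (simp add: pos_divide_le_eq)
qed

text \<open>For \<open>b = 1\<close> the denominator is affine in \<open>t\<close> with slope \<open>u - v > 0\<close>, so on \<open>[0, 1/2]\<close> the growth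
  factor is smallest at \<open>t = 1/2\<close>.\<close>

lemma biased_update_expands:
  assumes "0 \<le> w" "0 \<le> t" "t \<le> 1/2" "0 < v" "v < u"
  shows "(w + u) / (w + (u + v) / 2) * t \<le> biased_update w 1 t u v"
proof -
  let ?D = "w + t * u + (1 - t) * v"
  have D: "?D > 0"
    using assms by (intro add_nonneg_pos add_nonneg_nonneg mult_pos_pos mult_nonneg_nonneg) auto
  have "t * (u - v) \<le> 1/2 * (u - v)"
    using assms by (intro mult_right_mono) auto
  then have "?D \<le> w + (u + v) / 2"
    by (simp add: field_simps)
  then have "(w + u) * t / (w + (u + v) / 2) \<le> (w + u) * t / ?D"
    using assms D by (intro divide_left_mono mult_pos_pos add_nonneg_pos) auto
  then show ?thesis
    using assms by (simp add: biased_update_def algebra_simps)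
qed

section \<open>Deviations from a pole\<close>

text \<open>For a pole \<open>q \<in> {0, 1}\<close>, the total opinion of the agents other than \<open>i\<close> against and in favour
  of \<open>q\<close>.\<close>

definition opposition :: "real^'n::finite \<Rightarrow> 'n \<Rightarrow> real \<Rightarrow> real" where
  "opposition x i q = (\<Sum>j\<in>UNIV - {i}. \<bar>x $ j - q\<bar>)"

definition support :: "real^'n::finite \<Rightarrow> 'n \<Rightarrow> real \<Rightarrow> real" where
  "support x i q = (\<Sum>j\<in>UNIV - {i}. 1 - \<bar>x $ j - q\<bar>)"

lemma abs_diff_pole_le_1:
  assumes "x \<in> opinion_space" "q \<in> {0, 1}"
  shows "\<bar>x $ j - q\<bar> \<le> 1"
  using assms by (auto simp: opinion_space_def)

lemma opposition_nonneg: "0 \<le> opposition x i q"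
  unfolding opposition_def by (intro sum_nonneg) auto

lemma opposition_le_card:
  fixes x :: "real^'n::finite"
  assumes "x \<in> opinion_space" "q \<in> {0, 1}"
  shows "opposition x i q \<le> CARD('n)"
proof -
  have "opposition x i q \<le> of_nat (card (UNIV - {i})) * 1"
    unfolding opposition_def using abs_diff_pole_le_1[OF assms] by (intro sum_bounded_above) auto
  also have "\<dots> \<le> CARD('n)"
    by (simp add: card_Diff_singleton)
  finally show ?thesis .
qed

lemma support_nonneg:
  assumes "x \<in> opinion_space" "q \<in> {0, 1}"
  shows "0 \<le> support x i q"
  unfolding support_def using abs_diff_pole_le_1[OF assms] by (intro sum_nonneg) simp

lemma support_ge:
  assumes "x \<in> opinion_space" "q \<in> {0, 1}" "k \<noteq> i"
  shows "1 - \<bar>x $ k - q\<bar> \<le> support x i q"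
  unfolding support_def using assms abs_diff_pole_le_1[OF assms(1,2)]
  by (intro member_le_sum) auto

locale complete_opinion_dynamics =
  fixes E :: "('n::finite \<times> 'n) set" and W :: "real^'n^'n" and b :: "'n \<Rightarrow> real"
  assumes complete: "undirected_complete_graph E"
    and self_weight_nonneg: "\<And>i. 0 \<le> W $ i $ i"
    and unit_weight: "\<And>i j. i \<noteq> j \<Longrightarrow> W $ i $ j = 1"
begin

lemma neighbors_eq: "neighbors E i = UNIV - {i}"
  using complete by (auto simp: neighbors_def undirected_complete_graph_def irrefl_def)

lemma opinion_map_nth:
  assumes "x \<in> opinion_space"
  shows "opinion_map E W b x $ i
       = biased_update (W $ i $ i) (b i) (x $ i) (opposition x i 0) (support x i 0)"
proof -
  have op: "nbr_opinion E W x i = opposition x i 0"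
    unfolding nbr_opinion_def opposition_def neighbors_eq
    using assms by (intro sum.cong) (auto simp: unit_weight opinion_space_def)
  have "nbr_weight E W i - nbr_opinion E W x i = support x i 0"
    unfolding nbr_weight_def nbr_opinion_def support_def neighbors_eq sum_subtractf[symmetric]
    using assms by (intro sum.cong) (auto simp: unit_weight opinion_space_def)
  with op show ?thesis
    by (simp add: opinion_map_def biased_update_def)
qed

lemma opinion_map_in_space:
  assumes "x \<in> opinion_space"
  shows "opinion_map E W b x \<in> opinion_space"
proof -
  have "0 \<le> opinion_map E W b x $ i \<and> opinion_map E W b x $ i \<le> 1" for i
    unfolding opinion_map_nth[OF assms] using assms
    by (auto intro!: biased_update_bounds self_weight_nonneg opposition_nonneg support_nonneg
        simp: opinion_space_def)
  then show ?thesis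
    by (simp add: opinion_space_def)
qed

text \<open>For \<open>q = 1\<close> this is the symmetry of the rule under exchange of the opinions; the two
  strict inequalities keep its denominator positive.\<close>

lemma opinion_map_deviation:
  assumes x: "x \<in> opinion_space" and q: "q \<in> {0, 1}"
    and "\<bar>x $ i - q\<bar> < 1" "0 < support x i q"
  shows "\<bar>opinion_map E W b x $ i - q\<bar>
       = biased_update (W $ i $ i) (b i) \<bar>x $ i - q\<bar> (opposition x i q) (support x i q)"
proof -
  have range: "0 \<le> opinion_map E W b x $ i" "opinion_map E W b x $ i \<le> 1"
    using opinion_map_in_space[OF x] by (auto simp: opinion_space_def)
  have xi: "0 \<le> x $ j" "x $ j \<le> 1" for j
    using x by (auto simp: opinion_space_def)
  show ?thesis
  proof (cases "q = 0")
    case True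
    then show ?thesis
      using opinion_map_nth[OF x, of i] range xi by simp
  next
    case False
    with q have q1: "q = 1" by simp
    have swap: "opposition x i 0 = support x i 1" "support x i 0 = opposition x i 1"
      unfolding opposition_def support_def using xi by (auto intro!: sum.cong)
    have "0 < W $ i $ i + (1 - x $ i) powr b i * opposition x i 1
            + (1 - (1 - x $ i)) powr b i * support x i 1"
      using assms q1 xi[of i]
      by (intro biased_update_denominator_pos self_weight_nonneg opposition_nonneg) auto
    then have "W $ i $ i + x $ i powr b i * support x i 1
                 + (1 - x $ i) powr b i * opposition x i 1 \<noteq> 0"
      by simp
    from biased_update_flip[OF this] show ?thesis
      using opinion_map_nth[OF x, of i] range xi[of i] by (simp add: q1 swap)
  qed
qed

end

section \<open>Polarized equilibria\<close>

locale polarized_opinion_dynamics = complete_opinion_dynamics E W b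
  for E :: "('n::finite \<times> 'n) set" and W b +
  fixes p :: "real^'n"
  assumes pole: "\<And>i. p $ i \<in> {0, 1}"
    and companion: "\<And>i. \<exists>k. k \<noteq> i \<and> p $ k = p $ i"
begin

lemma polarized_in_space: "p \<in> opinion_space"
  unfolding opinion_space_def
proof (intro CollectI allI)
  fix i
  show "0 \<le> p $ i \<and> p $ i \<le> 1"
    using pole[of i] by auto
qed

text \<open>The one companion that an agent certainly has at its pole already bounds its support from
  below.\<close>

lemma support_ge_near:
  assumes "x \<in> opinion_space" "\<And>j. \<bar>x $ j - p $ j\<bar> \<le> \<delta>"
  shows "1 - \<delta> \<le> support x i (p $ i)"
proof -
  obtain k where k: "k \<noteq> i" "p $ k = p $ i"
    using companion by blast
  have "1 - \<bar>x $ k - p $ i\<bar> \<le> support x i (p $ i)"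
    using assms(1) pole k(1) by (rule support_ge)
  then show ?thesis
    using assms(2)[of k] k(2) by simp
qed

lemma opinion_map_deviation_near:
  assumes "x \<in> opinion_space" "\<And>j. \<bar>x $ j - p $ j\<bar> \<le> \<delta>" "\<delta> < 1"
  shows "\<bar>opinion_map E W b x $ i - p $ i\<bar>
       = biased_update (W $ i $ i) (b i) \<bar>x $ i - p $ i\<bar>
           (opposition x i (p $ i)) (support x i (p $ i))"
proof (rule opinion_map_deviation[OF assms(1) pole])
  show "\<bar>x $ i - p $ i\<bar> < 1"
    using assms(2)[of i] assms(3) by simp
  show "0 < support x i (p $ i)"
    using support_ge_near[OF assms(1,2), of i] assms(3) by simp
qed

text \<open>An agent at its pole has deviation 0, and the deviation rule fixes 0.\<close>

lemma opinion_map_fixes_pole: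
  assumes "x \<in> opinion_space" "\<And>j. \<bar>x $ j - p $ j\<bar> \<le> \<delta>" "\<delta> < 1" "x $ i = p $ i"
  shows "opinion_map E W b x $ i = p $ i"
  using opinion_map_deviation_near[OF assms(1-3), of i] assms(4) by simp

lemma polarized_equilibrium: "equilibrium (opinion_map E W b) opinion_space p"
  unfolding equilibrium_def vec_eq_iff
  using opinion_map_fixes_pole[OF polarized_in_space, of 0] polarized_in_space by simp

text \<open>The factor \<open>\<rho>\<close> is chosen first, above all the limiting rates \<open>w / (w + 1)\<close>; the radius is then
  taken so small that the actual rates lie below \<open>\<rho>\<close>.\<close>

lemma contraction_constants:
  assumes "\<And>i. 1 < b i"
  obtains \<rho> \<delta> where "0 < \<rho>" "\<rho> < 1" "0 < \<delta>" "\<delta> < 1"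
    and "\<And>i. W $ i $ i + \<delta> powr (b i - 1) * CARD('n)
             \<le> \<rho> * (W $ i $ i + (1 - \<delta>) powr b i * (1 - \<delta>))"
proof -
  have "\<forall>\<^sub>F \<rho> in at_left (1::real). W $ i $ i < \<rho> * (W $ i $ i + 1)" for i
  proof (rule order_tendstoD)
    show "((\<lambda>\<rho>. \<rho> * (W $ i $ i + 1)) \<longlongrightarrow> 1 * (W $ i $ i + 1)) (at_left 1)"
      by (intro tendsto_intros)
  qed simp
  then have "\<forall>\<^sub>F \<rho> in at_left (1::real). \<forall>i. W $ i $ i < \<rho> * (W $ i $ i + 1)"
    by (simp add: eventually_all_finite)
  moreover have "\<forall>\<^sub>F \<rho> in at_left (1::real). \<rho> \<in> {0<..<1}"
    by (intro eventually_at_leftI[of 0]) auto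
  ultimately have "\<forall>\<^sub>F \<rho> in at_left (1::real).
      (\<forall>i. W $ i $ i < \<rho> * (W $ i $ i + 1)) \<and> \<rho> \<in> {0<..<1}"
    by (rule eventually_conj)
  from eventually_happens'[OF trivial_limit_at_left_real this]
  obtain \<rho> where \<rho>: "0 < \<rho>" "\<rho> < 1" "\<And>i. W $ i $ i < \<rho> * (W $ i $ i + 1)"
    by auto
  have "\<forall>\<^sub>F \<delta> in at_right (0::real). W $ i $ i + \<delta> powr (b i - 1) * CARD('n)
             < \<rho> * (W $ i $ i + (1 - \<delta>) powr b i * (1 - \<delta>))" for i
  proof -
    let ?gap = "\<lambda>\<delta>. \<rho> * (W $ i $ i + (1 - \<delta>) powr b i * (1 - \<delta>))
                    - (W $ i $ i + \<delta> powr (b i - 1) * CARD('n))"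
    have "((\<lambda>\<delta>::real. \<delta> powr (b i - 1)) \<longlongrightarrow> 0) (at_right 0)"
      using assms[of i]
      by (intro tendsto_zero_powrI[where b = "b i - 1"] tendsto_intros)
         (auto intro: eventually_at_rightI[of 0 1])
    then have "((\<lambda>\<delta>. \<delta> powr (b i - 1) * CARD('n)) \<longlongrightarrow> 0) (at_right 0)"
      by (rule tendsto_mult_left_zero)
    then have "(?gap \<longlongrightarrow> \<rho> * (W $ i $ i + (1 - 0) powr b i * (1 - 0)) - (W $ i $ i + 0))
                 (at_right 0)"
      by (intro tendsto_diff tendsto_add) (auto intro!: tendsto_eq_intros)
    then have "\<forall>\<^sub>F \<delta> in at_right 0. 0 < ?gap \<delta>"
      by (rule order_tendstoD) (use \<rho>(3)[of i] in simp)
    then show ?thesis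
      by simp
  qed
  then have "\<forall>\<^sub>F \<delta> in at_right (0::real). \<forall>i. W $ i $ i + \<delta> powr (b i - 1) * CARD('n)
             < \<rho> * (W $ i $ i + (1 - \<delta>) powr b i * (1 - \<delta>))"
    by (simp add: eventually_all_finite)
  moreover have "\<forall>\<^sub>F \<delta> in at_right (0::real). \<delta> \<in> {0<..<1}"
    by (intro eventually_at_rightI[of 0 1]) auto
  ultimately have "\<forall>\<^sub>F \<delta> in at_right (0::real). (\<forall>i. W $ i $ i + \<delta> powr (b i - 1) * CARD('n)
             < \<rho> * (W $ i $ i + (1 - \<delta>) powr b i * (1 - \<delta>))) \<and> \<delta> \<in> {0<..<1}"
    by (rule eventually_conj)
  from eventually_happens'[OF trivial_limit_at_right_real this]
  obtain \<delta> where "0 < \<delta>" "\<delta> < 1" "\<And>i. W $ i $ i + \<delta> powr (b i - 1) * CARD('n)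
             < \<rho> * (W $ i $ i + (1 - \<delta>) powr b i * (1 - \<delta>))"
    by auto
  with \<rho>(1,2) show ?thesis
    using that[of \<rho> \<delta>] by (simp add: less_imp_le)
qed

text \<open>All deviations contract separately. A cube around \<open>p\<close> is therefore invariant, and the
  componentwise estimate carries over to the Euclidean distance.\<close>

lemma polarized_exponentially_stable:
  assumes "\<And>i. 1 < b i"
  shows "locally_exponentially_stable (opinion_map E W b) opinion_space p"
proof -
  let ?F = "opinion_map E W b"
  obtain \<rho> \<delta> where \<rho>: "0 < \<rho>" "\<rho> < 1" and \<delta>: "0 < \<delta>" "\<delta> < 1"
    and small: "\<And>i. W $ i $ i + \<delta> powr (b i - 1) * CARD('n)
                  \<le> \<rho> * (W $ i $ i + (1 - \<delta>) powr b i * (1 - \<delta>))"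
    using contraction_constants[OF assms] by blast
  have step: "\<bar>?F x $ i - p $ i\<bar> \<le> \<rho> * \<bar>x $ i - p $ i\<bar>"
    if x: "x \<in> opinion_space" "\<And>j. \<bar>x $ j - p $ j\<bar> \<le> \<delta>" for x i
    unfolding opinion_map_deviation_near[OF x \<delta>(2)]
    using \<rho> \<delta> x assms small
    by (intro biased_update_contracts[where \<delta> = \<delta> and U = "CARD('n)"] self_weight_nonneg
        opposition_nonneg opposition_le_card pole support_ge_near) auto
  have decay: "(?F ^^ k) x \<in> opinion_space
      \<and> (\<forall>i. \<bar>(?F ^^ k) x $ i - p $ i\<bar> \<le> \<rho> ^ k * \<bar>x $ i - p $ i\<bar>)"
    if x: "x \<in> opinion_space" "\<And>j. \<bar>x $ j - p $ j\<bar> \<le> \<delta>" for x k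
  proof (induction k)
    case 0
    show ?case
      using x by simp
  next
    case (Suc k)
    let ?z = "(?F ^^ k) x"
    have z: "?z \<in> opinion_space" "\<bar>?z $ j - p $ j\<bar> \<le> \<rho> ^ k * \<bar>x $ j - p $ j\<bar>" for j
      using Suc.IH by auto
    have near: "\<bar>?z $ j - p $ j\<bar> \<le> \<delta>" for j
    proof -
      note z(2)
      also have "\<rho> ^ k * \<bar>x $ j - p $ j\<bar> \<le> \<bar>x $ j - p $ j\<bar>"
        using \<rho> by (intro mult_left_le_one_le power_le_one) auto
      also note x(2)
      finally show ?thesis .
    qed
    have "\<bar>?F ?z $ i - p $ i\<bar> \<le> \<rho> * (\<rho> ^ k * \<bar>x $ i - p $ i\<bar>)" for i
      using step[OF z(1) near] mult_left_mono[OF z(2)] \<rho>(1) by (meson less_imp_le order_trans)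
    then show ?case
      using opinion_map_in_space[OF z(1)] by (simp add: mult.assoc)
  qed
  have "dist ((?F ^^ k) x) p \<le> 1 * \<rho> ^ k * dist x p"
    if x: "x \<in> opinion_space" "dist x p < \<delta>" for x k
  proof -
    have "\<bar>x $ j - p $ j\<bar> \<le> \<delta>" for j
      using dist_vec_nth_le[of x j p] x(2) by (simp add: dist_real_def)
    then have "\<bar>(?F ^^ k) x $ i - p $ i\<bar> \<le> \<rho> ^ k * \<bar>x $ i - p $ i\<bar>" for i
      using decay[OF x(1)] by blast
    then have "norm ((?F ^^ k) x - p) \<le> norm (\<rho> ^ k *\<^sub>R (x - p))"
      using \<rho> by (intro norm_le_componentwise_cart) (simp add: abs_mult)
    then show ?thesis
      using \<rho> by (simp add: dist_norm)
  qed
  then show ?thesis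
    unfolding locally_exponentially_stable_def
    using \<rho> \<delta>(1) by (intro exI[of _ \<delta>] exI[of _ 1] exI[of _ \<rho>] conjI) auto
qed

text \<open>While only agent \<open>i\<close> deviates, its opposition and support are the constant head counts of the
  other pole and of its companions.\<close>

lemma head_counts:
  assumes "\<And>j. j \<noteq> i \<Longrightarrow> x $ j = p $ j"
  shows "opposition x i (p $ i) = card {j. p $ j \<noteq> p $ i}"
    and "support x i (p $ i) = card {j. p $ j = p $ i} - 1"
proof -
  have "opposition x i (p $ i) = (\<Sum>j\<in>UNIV - {i}. if p $ j \<noteq> p $ i then 1 else 0)"
    unfolding opposition_def
  proof (rule sum.cong)
    fix j assume "j \<in> UNIV - {i}"
    then show "\<bar>x $ j - p $ i\<bar> = (if p $ j \<noteq> p $ i then 1 else 0)"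
      using assms[of j] pole[of i] pole[of j] by auto
  qed simp
  also have "\<dots> = card ((UNIV - {i}) \<inter> {j. p $ j \<noteq> p $ i})"
    by (simp add: sum.If_cases)
  also have "(UNIV - {i}) \<inter> {j. p $ j \<noteq> p $ i} = {j. p $ j \<noteq> p $ i}"
    by auto
  finally show "opposition x i (p $ i) = card {j. p $ j \<noteq> p $ i}" .
  have "support x i (p $ i) = (\<Sum>j\<in>UNIV - {i}. if p $ j = p $ i then 1 else 0)"
    unfolding support_def
  proof (rule sum.cong)
    fix j assume "j \<in> UNIV - {i}"
    then show "1 - \<bar>x $ j - p $ i\<bar> = (if p $ j = p $ i then 1 else 0)"
      using assms[of j] pole[of i] pole[of j] by auto
  qed simp
  also have "\<dots> = card ((UNIV - {i}) \<inter> {j. p $ j = p $ i})"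
    by (simp add: sum.If_cases)
  also have "(UNIV - {i}) \<inter> {j. p $ j = p $ i} = {j. p $ j = p $ i} - {i}"
    by auto
  finally show "support x i (p $ i) = card {j. p $ j = p $ i} - 1"
    by (simp add: card_Diff_singleton)
qed

lemma card_companions_ge_2: "2 \<le> card {j. p $ j = p $ i}"
proof -
  obtain k where "k \<noteq> i" "p $ k = p $ i"
    using companion by blast
  then have "card {i, k} \<le> card {j. p $ j = p $ i}"
    by (intro card_mono) auto
  with \<open>k \<noteq> i\<close> show ?thesis by simp
qed

text \<open>A perturbation of agent \<open>i\<close> alone spreads to nobody else and grows in each step by a
  fixed factor \<open>r > 1\<close> at least as long as it is below \<open>1/2\<close>, so it must pass \<open>1/2\<close>.\<close>

lemma polarized_unstable:
  assumes b: "\<And>j. b j = 1"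
    and minority: "card {j. p $ j = p $ i} \<le> card {j. p $ j \<noteq> p $ i}"
  shows "unstable (opinion_map E W b) opinion_space p"
  unfolding unstable_def
proof
  let ?F = "opinion_map E W b"
  let ?w = "W $ i $ i"
  define u where "u = real (card {j. p $ j \<noteq> p $ i})"
  define v where "v = real (card {j. p $ j = p $ i} - 1)"
  define r where "r = (?w + u) / (?w + (u + v) / 2)"
  have uv: "0 < v" "v < u"
    using card_companions_ge_2[of i] minority by (auto simp: u_def v_def)
  have r: "1 < r"
    unfolding r_def using uv self_weight_nonneg[of i] 
    by (subst less_divide_eq_1_pos) (auto intro!: add_nonneg_pos)
  assume "lyapunov_stable ?F opinion_space p"
  then obtain \<delta> where \<delta>: "0 < \<delta>"
    and stable: "\<And>x k. x \<in> opinion_space \<Longrightarrow> dist x p < \<delta> \<Longrightarrow> dist ((?F ^^ k) x) p < 1/2"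
    unfolding lyapunov_stable_def by (meson half_gt_zero zero_less_one)
  define y where "y = min (\<delta> / 2) (1/2)"
  have y: "0 < y" "y \<le> 1/2" "y < \<delta>"
    using \<delta> by (auto simp: y_def)
  \<comment> \<open>From either pole, \<open>\<bar>p $ i - y\<bar>\<close> lies inside the unit interval at distance \<open>y\<close>.\<close>
  define x where "x = (\<chi> j. if j = i then \<bar>p $ i - y\<bar> else p $ j)"
  have x_other: "x $ j = p $ j" if "j \<noteq> i" for j
    using that by (simp add: x_def)
  have x_self: "\<bar>x $ i - p $ i\<bar> = y"
    using y pole[of i] by (auto simp: x_def)
  have x_space: "x \<in> opinion_space"
    unfolding opinion_space_def
  proof (intro CollectI allI)
    fix j
    show "0 \<le> x $ j \<and> x $ j \<le> 1"
      using y pole[of i] pole[of j] by (auto simp: x_def)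
  qed
  have "x - p = (x $ i - p $ i) *\<^sub>R axis i 1"
    using x_other by (auto simp: vec_eq_iff axis_def)
  then have "dist x p < \<delta>"
    using x_self y(3) by (simp add: dist_norm norm_axis_1)
  then have bounded: "dist ((?F ^^ k) x) p < 1/2" for k
    by (rule stable[OF x_space])
  have growth: "(?F ^^ k) x \<in> opinion_space \<and> (\<forall>j. j \<noteq> i \<longrightarrow> (?F ^^ k) x $ j = p $ j)
      \<and> r ^ k * y \<le> \<bar>(?F ^^ k) x $ i - p $ i\<bar>" for k
  proof (induction k)
    case 0
    show ?case
      using x_space x_other x_self by simp
  next
    case (Suc k)
    let ?z = "(?F ^^ k) x"
    have z: "?z \<in> opinion_space" "\<And>j. j \<noteq> i \<Longrightarrow> ?z $ j = p $ j"
        "r ^ k * y \<le> \<bar>?z $ i - p $ i\<bar>"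
      using Suc.IH by auto
    have near: "\<bar>?z $ j - p $ j\<bar> \<le> 1/2" for j
      using dist_vec_nth_le[of ?z j p] bounded[of k] by (simp add: dist_real_def)
    have "r ^ Suc k * y \<le> r * \<bar>?z $ i - p $ i\<bar>"
      using z(3) r by (simp add: mult.assoc)
    also have "\<dots> \<le> biased_update ?w 1 \<bar>?z $ i - p $ i\<bar> u v"
      unfolding r_def using uv near self_weight_nonneg by (intro biased_update_expands) auto
    also have "\<dots> = \<bar>?F ?z $ i - p $ i\<bar>"
      using opinion_map_deviation_near[OF z(1) near, of i] head_counts[of i ?z] z(2) b
      by (simp add: u_def v_def)
    finally have "r ^ Suc k * y \<le> \<bar>?F ?z $ i - p $ i\<bar>" .
    moreover have "?F ?z $ j = p $ j" if "j \<noteq> i" for j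
      using opinion_map_fixes_pole[OF z(1) near] z(2)[OF that] by simp
    ultimately show ?case
      using opinion_map_in_space[OF z(1)] by simp
  qed
  obtain k where "1 / y < r ^ k"
    using real_arch_pow[OF r] by blast
  then have "1 < r ^ k * y"
    using y by (simp add: divide_less_eq)
  moreover have "\<bar>(?F ^^ k) x $ i - p $ i\<bar> < 1/2"
    using dist_vec_nth_le[of "(?F ^^ k) x" i p] bounded[of k] by (simp add: dist_real_def)
  ultimately show False
    using growth[of k] by auto
qed

end

section \<open>The block vector of zeros and ones\<close>

text \<open>Positions in the ordering number the agents bijectively, so the two blocks of the vector
  have the sizes that they have in the list.\<close>

lemma bij_betw_position:
  "bij_betw (\<lambda>i::'n::{finite,linorder}. card {..<i}) UNIV {..<CARD('n)}"
proof -
  have "strict_mono (\<lambda>i::'n. card {..<i})"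
    by (intro strict_monoI psubset_card_mono) auto
  then have inj: "inj (\<lambda>i::'n. card {..<i})"
    by (rule strict_mono_imp_inj_on)
  have "card {..<i} < CARD('n)" for i :: 'n
    by (rule psubset_card_mono) auto
  then have "range (\<lambda>i::'n. card {..<i}) = {..<CARD('n)}"
    using inj by (intro card_subset_eq) (auto simp: card_image)
  with inj show ?thesis
    by (simp add: bij_betw_def)
qed

lemma zeros_ones_nth:
  fixes i :: "'n::{finite,linorder}"
  assumes "n1 + n2 = CARD('n)"
  shows "zeros_ones n1 n2 $ i = (if card {..<i} < n1 then 0 else 1)"
proof -
  have "card {..<i} < n1 + n2"
    using bij_betw_apply[OF bij_betw_position, of i] assms by simp
  then show ?thesis
    by (simp add: zeros_ones_def nth_append)
qed

lemma card_zeros_ones_blocks: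
  assumes "n1 + n2 = CARD('n::{finite,linorder})"
  shows "card {i::'n. zeros_ones n1 n2 $ i = 0} = n1"
    and "card {i::'n. zeros_ones n1 n2 $ i = 1} = n2"
proof -
  let ?h = "\<lambda>i::'n. card {..<i}"
  have count: "card {i. ?h i \<in> A} = card A" if "A \<subseteq> {..<CARD('n)}" for A
    using card_vimage_inj[of ?h A] bij_betw_position[where 'n = 'n] that
    by (simp add: bij_betw_def vimage_def)
  have "{i::'n. zeros_ones n1 n2 $ i = 0} = {i. ?h i \<in> {..<n1}}"
    using assms by (auto simp: zeros_ones_nth split: if_splits)
  then show "card {i::'n. zeros_ones n1 n2 $ i = 0} = n1"
    using count[of "{..<n1}"] assms by auto
  have "{i::'n. zeros_ones n1 n2 $ i = 1} = {i. ?h i \<in> {n1..<CARD('n)}}"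
    using assms bij_betw_apply[OF bij_betw_position]
    by (auto simp: zeros_ones_nth split: if_splits)
  then show "card {i::'n. zeros_ones n1 n2 $ i = 1} = n2"
    using count[of "{n1..<CARD('n)}"] assms by (simp add: subset_eq)
qed

section \<open>Stability of the polarized equilibrium\<close>

theorem theorem5:
  fixes E :: "('n::{finite,linorder} \<times> 'n) set"
    and W :: "((real, 'n) vec, 'n) vec"
    and b :: "'n \<Rightarrow> real"
    and n1 n2 N :: nat
  assumes "N = CARD('n)"
    and "undirected_complete_graph E"
    and "\<And>i. W $ i $ i \<ge> 0"
    and "\<And>i j. i \<noteq> j \<Longrightarrow> W $ i $ j = 1"
    and "n1 \<in> {2..N - 2}"
    and "n1 + n2 = N"
  shows "((\<forall>i. b i = 1) \<longrightarrow>
            equilibrium (opinion_map E W b) opinion_space (zeros_ones n1 n2) \<and>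
            unstable (opinion_map E W b) opinion_space (zeros_ones n1 n2)) \<and>
         ((\<forall>i. b i > 1) \<longrightarrow>
            equilibrium (opinion_map E W b) opinion_space (zeros_ones n1 n2) \<and>
            locally_exponentially_stable (opinion_map E W b) opinion_space (zeros_ones n1 n2))"
proof -
  let ?p = "zeros_ones n1 n2 :: (real, 'n) vec"
  have N: "n1 + n2 = CARD('n)" and n: "2 \<le> n1" "2 \<le> n2"
    using assms(1,5,6) by auto
  note blocks = card_zeros_ones_blocks[OF N]
  have pole: "?p $ i \<in> {0, 1}" for i
    by (simp add: zeros_ones_nth[OF N])
  have companion: "\<exists>k. k \<noteq> i \<and> ?p $ k = ?p $ i" for i
  proof (rule ccontr)
    assume "\<not> (\<exists>k. k \<noteq> i \<and> ?p $ k = ?p $ i)"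
    then have "{k. ?p $ k = ?p $ i} = {i}"
      by auto
    then have "card {k. ?p $ k = ?p $ i} = 1"
      by simp
    with blocks n pole[of i] show False
      by auto
  qed
  interpret polarized_opinion_dynamics E W b ?p
    using assms(2-4) pole companion by unfold_locales auto
  have others: "{j. ?p $ j \<noteq> 0} = {j. ?p $ j = 1}" "{j. ?p $ j \<noteq> 1} = {j. ?p $ j = 0}"
    using pole by fastforce+
  \<comment> \<open>The group that is not the larger one supplies the unstable agent.\<close>
  have minority: "\<exists>i. card {j. ?p $ j = ?p $ i} \<le> card {j. ?p $ j \<noteq> ?p $ i}"
  proof (cases "n1 \<le> n2")
    case True
    obtain i where "?p $ i = 0"
      using blocks(1) n(1) by (metis (mono_tags) card.empty empty_Collect_eq not_numeral_le_zero)
    then show ?thesis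
      using True blocks others by (intro exI[of _ i]) simp
  next
    case False
    obtain i where "?p $ i = 1"
      using blocks(2) n(2) by (metis (mono_tags) card.empty empty_Collect_eq not_numeral_le_zero)
    then show ?thesis
      using False blocks others by (intro exI[of _ i]) simp
  qed
  show ?thesis
    using polarized_equilibrium polarized_exponentially_stable polarized_unstable minority by blast
qed

end
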